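(* Let $H$ be a real Hilbert space and $f:H\to\mathbb{R}\cup\{+\infty\}$ a lower semicontinuous proper convex function with $\inf f=0$. The following statements are equivalent: (i) There exist $r_0>0$ and $\varphi\in\mathcal{K}(0,r_0)$ such that $\|\partial(\varphi\circ f)(x)\|_-\ge1$ for all $x\in[0<f\le r_0]$. (ii) There exists a concave function $\psi\in\mathcal{K}(0,\infty)$ such that $\|\partial(\psi\circ f)(x)\|_-\ge1$ for all $x\notin[f=0]$.
   Context: $\partial g$ denotes the Fréchet subdifferential: $p\in\partial g(x)$ ($x\in\operatorname{dom}g$) iff $\liminf_{y\to x,y\ne x}\frac{g(y)-g(x)-\langle p,y-x\rangle}{\|y-x\|}\ge0$, and $\partial g(x)=\emptyset$ outside $\operatorname{dom}g$. $\|C\|_-=\inf\{\|p\|:p\in C\}$, equal to $+\infty$ if $C=\emptyset$. $\mathcal{K}(0,\bar r)$ ($\bar r\in(0,+\infty]$): functions $\varphi\in C([0,\bar r))\cap C^1(0,\bar r)$ with $\varphi(0)=0$ and $\varphi'>0$ on $(0,\bar r)$. $[0<f\le r_0]=\{x:0<f(x)\le r_0\}$. *)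

theory Defs
  imports "HOL-Analysis.Analysis" "HOL-Library.Extended_Real"
begin

definition edom :: "('a \<Rightarrow> ereal) \<Rightarrow> 'a set" where
  "edom g = {x. \<bar>g x\<bar> \<noteq> \<infinity>}"

definition lsc_ext :: "('a::topological_space \<Rightarrow> ereal) \<Rightarrow> bool" where
  "lsc_ext f \<longleftrightarrow> (\<forall>x. f x \<le> Liminf (at x) f)"

definition proper_ext :: "('a \<Rightarrow> ereal) \<Rightarrow> bool" where
  "proper_ext f \<longleftrightarrow> (\<exists>x. f x < \<infinity>) \<and> (\<forall>x. f x > -\<infinity>)"

definition convex_ext :: "('a::real_vector \<Rightarrow> ereal) \<Rightarrow> bool" where
  "convex_ext f \<longleftrightarrow> (\<forall>x y t. 0 < t \<and> t < 1 \<longrightarrow>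
      f ((1 - t) *\<^sub>R x + t *\<^sub>R y) \<le> ereal (1 - t) * f x + ereal t * f y)"

definition frechet_subdiff :: "('a::real_inner \<Rightarrow> ereal) \<Rightarrow> 'a \<Rightarrow> 'a set" where
  "frechet_subdiff g x =
     (if x \<in> edom g then
        {p. Liminf (at x) (\<lambda>y. (g y - g x - ereal (inner p (y - x))) / ereal (norm (y - x))) \<ge> 0}
      else {})"

text \<open>Lower norm ||C||_- = inf of norms, +\<infinity> for the empty set.\<close>
definition lower_norm :: "'a::real_normed_vector set \<Rightarrow> ereal" where
  "lower_norm C = (INF p\<in>C. ereal (norm p))"

definition classK :: "ereal \<Rightarrow> (real \<Rightarrow> real) \<Rightarrow> bool" where
  "classK rb \<phi> \<longleftrightarrow>
     continuous_on {t. 0 \<le> t \<and> ereal t < rb} \<phi> \<and>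
     (\<forall>t. 0 < t \<and> ereal t < rb \<longrightarrow> \<phi> differentiable (at t)) \<and>
     continuous_on {t. 0 < t \<and> ereal t < rb} (deriv \<phi>) \<and>
     \<phi> 0 = 0 \<and>
     (\<forall>t. 0 < t \<and> ereal t < rb \<longrightarrow> deriv \<phi> t > 0)"

text \<open>Composition \<phi> \<circ> f for \<phi> defined on [0, rb): value +\<infinity> whenever f x is not in [0, rb).\<close>
definition compK :: "(real \<Rightarrow> real) \<Rightarrow> ereal \<Rightarrow> ('a \<Rightarrow> ereal) \<Rightarrow> 'a \<Rightarrow> ereal" where
  "compK \<phi> rb f x = (if 0 \<le> f x \<and> f x < rb \<and> f x \<noteq> \<infinity> then ereal (\<phi> (real_of_ereal (f x))) else \<infinity>)"

end

theory Submission
  imports Defs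
begin

text \<open>For an increasing differentiable \<open>\<phi>\<close>, the Frechet subgradients of \<open>\<phi> \<circ> f\<close> at a point of value
  \<open>r\<close> are exactly the multiples by \<open>\<phi>' r\<close> of the convex subgradients of \<open>f\<close>, so the inequality says
  that every subgradient at level \<open>r\<close> has norm at least \<open>1 / \<phi>' r\<close>. By convexity, projecting a point
  on a lower sublevel set produces there a subgradient of no larger norm. Hence the inequality
  at level \<open>r\<close> holds with \<open>\<phi>' s\<close> for every \<open>s \<le> r\<close>, and \<open>\<phi>'\<close> may be replaced by the infimum of
  \<open>\<phi>'\<close> over all lower levels. This infimum is decreasing and continuous, and \<open>\<phi>'\<close> can be frozen beyond
  some level below \<open>r0\<close> beforehand; the antiderivative is the concave global function.\<close>

section \<open>Real functions of one variable\<close>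

lemma MVT_deriv_interior:
  fixes f :: "real \<Rightarrow> real"
  assumes "a < b" "continuous_on {a..b} f"
    and deriv: "\<And>x. a < x \<Longrightarrow> x < b \<Longrightarrow> (f has_real_derivative f' x) (at x)"
  shows "\<exists>x. a < x \<and> x < b \<and> f b - f a = (b - a) * f' x"
proof -
  obtain l x where x: "a < x" "x < b" "(f has_real_derivative l) (at x)" "f b - f a = (b - a) * l"
    using MVT[OF assms(1,2)] deriv real_differentiable_def by meson
  moreover have "l = f' x"
    using x deriv DERIV_unique by blast
  ultimately show ?thesis by blast
qed

lemma concave_on_antimono_deriv_interior:
  fixes f :: "real \<Rightarrow> real"
  assumes "convex A" and cont: "continuous_on A f"
    and deriv: "\<And>x. x \<in> interior A \<Longrightarrow> (f has_real_derivative f' x) (at x)"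
    and anti: "antimono_on (interior A) f'"
  shows "concave_on A f"
proof (rule concave_on_linorderI)
  fix t x y :: real
  assume t: "0 < t" "t < 1" and xy: "x \<in> A" "y \<in> A" "x < y"
  define z where "z = (1 - t) *\<^sub>R x + t *\<^sub>R y"
  have z_diff: "z - x = t * (y - x)" "y - z = (1 - t) * (y - x)"
    by (simp_all add: z_def algebra_simps)
  then have "0 < z - x" "0 < y - z" using t xy by simp_all
  then have z: "x < z" "z < y" by simp_all
  have Icc: "{x..y} \<subseteq> A"
    using closed_segment_subset[OF xy(1,2) \<open>convex A\<close>] xy(3) by (simp add: closed_segment_eq_real_ivl)
  then have Ioo: "{x<..<y} \<subseteq> interior A"
    by (intro interior_maximal) auto
  have mean_value: "\<exists>\<xi>. u < \<xi> \<and> \<xi> < v \<and> f v - f u = (v - u) * f' \<xi>"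
    if "x \<le> u" "u < v" "v \<le> y" for u v
  proof (rule MVT_deriv_interior[OF \<open>u < v\<close>])
    show "continuous_on {u..v} f"
      using cont by (rule continuous_on_subset) (use that Icc in auto)
    show "(f has_real_derivative f' \<xi>) (at \<xi>)" if "u < \<xi>" "\<xi> < v" for \<xi>
      using that \<open>x \<le> u\<close> \<open>v \<le> y\<close> Ioo by (intro deriv) auto
  qed
  obtain \<xi> where \<xi>: "x < \<xi>" "\<xi> < z" "f z - f x = (z - x) * f' \<xi>"
    using mean_value[of x z] z by auto
  obtain \<eta> where \<eta>: "z < \<eta>" "\<eta> < y" "f y - f z = (y - z) * f' \<eta>"
    using mean_value[of z y] z by auto
  have "f' \<eta> \<le> f' \<xi>"
    using \<xi>(1,2) \<eta>(1,2) Ioo by (intro monotone_onD[OF anti]) auto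
  then have "t * (1 - t) * (y - x) * f' \<eta> \<le> t * (1 - t) * (y - x) * f' \<xi>"
    using t xy by (intro mult_left_mono) auto
  then have "t * (f y - f z) \<le> (1 - t) * (f z - f x)"
    unfolding \<xi>(3) \<eta>(3) z_diff by (simp add: mult_ac)
  then show "(1 - t) * f x + t * f y \<le> f ((1 - t) *\<^sub>R x + t *\<^sub>R y)"
    unfolding z_def[symmetric] by (simp add: algebra_simps)
qed fact

lemma has_real_derivative_integral_upper_limit:
  fixes g :: "real \<Rightarrow> real"
  assumes "g integrable_on {a..b}" and t: "a < t" "t < b" and "isCont g t"
  shows "((\<lambda>u. integral {a..u} g) has_real_derivative g t) (at t)"
proof -
  have "((\<lambda>u. integral {a..u} g) has_vector_derivative g t) (at t within {a..b})"
    using integral_has_vector_derivative_continuous_at[of g a b t "{}"] assms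
    by (simp add: continuous_at_imp_continuous_at_within)
  then show ?thesis
    using t by (simp add: has_real_derivative_iff_has_vector_derivative at_within_Icc_at)
qed

lemma integrable_on_Icc_dominated:
  fixes g :: "real \<Rightarrow> 'a::euclidean_space"
  assumes "continuous_on {a<..<b} g" and "k integrable_on {a..b}"
    and "\<And>t. a < t \<Longrightarrow> t < b \<Longrightarrow> norm (g t) \<le> k t"
  shows "g integrable_on {a..b}"
  unfolding integrable_on_Icc_iff_Ioo
proof (rule measurable_bounded_by_integrable_imp_integrable)
  show "g \<in> borel_measurable (lebesgue_on {a<..<b})"
    using assms(1) by (rule continuous_imp_measurable_on_sets_lebesgue) simp
  show "k integrable_on {a<..<b}"
    using assms(2) by (simp add: integrable_on_Icc_iff_Ioo)
qed (use assms(3) in auto)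

lemma integrable_on_Icc_extend_right:
  fixes g :: "real \<Rightarrow> 'a::banach"
  assumes integrable: "g integrable_on {c..a}" and "c < a" and cont: "continuous_on {c<..} g"
  shows "g integrable_on {c..b}"
proof -
  have "continuous_on {a..max a b} g"
    using cont by (rule continuous_on_subset) (use \<open>c < a\<close> in auto)
  then have "g integrable_on {c..max a b}"
    using Henstock_Kurzweil_Integration.integrable_combine[OF _ _ integrable] \<open>c < a\<close>
    by (simp add: integrable_continuous_real)
  then show ?thesis
    by (rule integrable_subinterval_real) auto
qed

definition running_inf :: "(real \<Rightarrow> real) \<Rightarrow> real \<Rightarrow> real" where
  "running_inf h t = (INF s\<in>{0<..t}. h s)"

lemma running_inf_le:
  assumes "bdd_below (h ` {0<..})" and "0 < s" "s \<le> t"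
  shows "running_inf h t \<le> h s"
  unfolding running_inf_def
  using assms by (intro cINF_lower bdd_below_mono[OF assms(1)]) auto

lemma running_inf_greatest:
  assumes "0 < t" and "\<And>s. 0 < s \<Longrightarrow> s \<le> t \<Longrightarrow> m \<le> h s"
  shows "m \<le> running_inf h t"
  unfolding running_inf_def using assms by (intro cINF_greatest) auto

lemma antimono_on_running_inf:
  assumes "bdd_below (h ` {0<..})"
  shows "antimono_on {0<..} (running_inf h)"
  using assms by (intro monotone_onI running_inf_greatest running_inf_le) auto

lemma running_inf_le_add:
  assumes bdd: "bdd_below (h ` {0<..})" and "0 < t" "t \<le> t'"
    and osc: "\<And>s. t \<le> s \<Longrightarrow> s \<le> t' \<Longrightarrow> h t \<le> h s + e" and "0 \<le> e"
  shows "running_inf h t \<le> running_inf h t' + e"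
proof -
  have "running_inf h t - e \<le> h s" if "0 < s" "s \<le> t'" for s
  proof (cases "s \<le> t")
    case True
    then show ?thesis using running_inf_le[OF bdd \<open>0 < s\<close>, of t] \<open>0 \<le> e\<close> by simp
  next
    case False
    then show ?thesis using running_inf_le[OF bdd \<open>0 < t\<close>, of t] osc[of s] that by simp
  qed
  then have "running_inf h t - e \<le> running_inf h t'"
    using assms(2,3) by (intro running_inf_greatest) auto
  then show ?thesis by simp
qed

lemma continuous_on_running_inf:
  assumes bdd: "bdd_below (h ` {0<..})" and "continuous_on {0<..} h"
  shows "continuous_on {0<..} (running_inf h)"
proof (rule continuous_at_imp_continuous_on, rule ballI)
  fix t :: real assume "t \<in> {0<..}"
  then have "0 < t" "isCont h t"
    using assms(2) by (auto simp: continuous_on_eq_continuous_at)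
  show "isCont (running_inf h) t"
    unfolding continuous_at_eps_delta
  proof (intro allI impI)
    fix e :: real assume "0 < e"
    then obtain \<delta> where \<delta>: "0 < \<delta>" "\<And>s. \<bar>s - t\<bar> < \<delta> \<Longrightarrow> \<bar>h s - h t\<bar> < e / 4"
      using \<open>isCont h t\<close> unfolding continuous_at_eps_delta dist_real_def
      by (metis divide_pos_pos zero_less_numeral)
    have osc: "\<bar>running_inf h u - running_inf h v\<bar> \<le> e / 2"
      if "0 < u" "u \<le> v" "\<bar>u - t\<bar> < \<delta>" "\<bar>v - t\<bar> < \<delta>" for u v
    proof -
      have "running_inf h u \<le> running_inf h v + e / 2"
      proof (rule running_inf_le_add[OF bdd that(1,2)])
        fix s assume "u \<le> s" "s \<le> v"
        then have "\<bar>s - t\<bar> < \<delta>" using that by linarith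
        then show "h u \<le> h s + e / 2" using \<delta>(2)[of s] \<delta>(2)[of u] that by linarith
      qed (use \<open>0 < e\<close> in simp)
      moreover have "running_inf h v \<le> running_inf h u"
        using monotone_onD[OF antimono_on_running_inf[OF bdd], of u v] that by simp
      ultimately show ?thesis by simp
    qed
    have "dist (running_inf h s) (running_inf h t) < e" if "dist s t < min \<delta> t" for s
      using osc[of s t] osc[of t s] that \<delta>(1) \<open>0 < t\<close> \<open>0 < e\<close>
      by (cases "s \<le> t") (auto simp: dist_real_def abs_minus_commute)
    then show "\<exists>d>0. \<forall>s. dist s t < d \<longrightarrow> dist (running_inf h s) (running_inf h t) < e"
      using \<delta>(1) \<open>0 < t\<close> by (intro exI[of _ "min \<delta> t"]) auto
  qed
qed

section \<open>The class of desingularizing functions\<close>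

lemma ereal_le_less_trans:
  assumes "u \<le> t" "ereal t < b"
  shows "ereal u < b"
  using le_less_trans[of "ereal u" "ereal t" b] assms by simp

lemma classK_deriv:
  assumes "classK rb \<phi>" "0 < t" "ereal t < rb"
  shows "(\<phi> has_real_derivative deriv \<phi> t) (at t)" "deriv \<phi> t > 0"
  using assms by (auto simp: classK_def DERIV_deriv_iff_real_differentiable)

lemma classK_antimono_radius:
  assumes "classK rb \<phi>" "rb' \<le> rb"
  shows "classK rb' \<phi>"
  using assms unfolding classK_def
  by (auto elim!: continuous_on_subset intro: less_le_trans)

lemma classK_continuous_on_Icc:
  assumes "classK rb \<phi>" "0 \<le> s" "ereal t < rb"
  shows "continuous_on {s..t} \<phi>"
  by (rule continuous_on_subset[where s = "{t. 0 \<le> t \<and> ereal t < rb}"])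
    (use assms in \<open>auto simp: classK_def intro: ereal_le_less_trans\<close>)

lemma classK_mono_on:
  assumes K: "classK rb \<phi>"
  shows "mono_on {t. 0 \<le> t \<and> ereal t < rb} \<phi>"
proof (rule mono_onI)
  fix s t
  assume s: "s \<in> {t. 0 \<le> t \<and> ereal t < rb}" and t: "t \<in> {t. 0 \<le> t \<and> ereal t < rb}"
    and "s \<le> t"
  show "\<phi> s \<le> \<phi> t"
  proof (cases "s = t")
    case False
    have "\<phi> s < \<phi> t"
    proof (rule DERIV_pos_imp_increasing_open[where f = \<phi>])
      show "s < t" using False \<open>s \<le> t\<close> by simp
      show "\<exists>y. (\<phi> has_real_derivative y) (at u) \<and> 0 < y" if "s < u" "u < t" for u
        using classK_deriv[OF K, of u] ereal_le_less_trans[of u t rb] that s t by auto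
      show "continuous_on {s..t} \<phi>"
        using classK_continuous_on_Icc[OF K] s t by simp
    qed
    then show ?thesis by simp
  qed simp
qed

lemma classK_deriv_integrable_on:
  assumes "classK rb \<phi>" and "0 \<le> a" "ereal a < rb"
  shows "deriv \<phi> integrable_on {0..a}"
proof -
  have "(deriv \<phi> has_integral \<phi> a - \<phi> 0) {0..a}"
  proof (rule fundamental_theorem_of_calculus_interior[OF \<open>0 \<le> a\<close>])
    show "continuous_on {0..a} \<phi>"
      using classK_continuous_on_Icc[OF assms(1) _ assms(3)] by simp
    show "(\<phi> has_vector_derivative deriv \<phi> t) (at t)" if "t \<in> {0<..<a}" for t
      using classK_deriv(1)[OF assms(1), of t] ereal_le_less_trans[OF _ assms(3), of t] that
      by (simp add: has_real_derivative_iff_has_vector_derivative)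
  qed
  then show ?thesis by blast
qed

lemma classK_concave_on:
  assumes K: "classK \<infinity> \<psi>" and "antimono_on {0<..} (deriv \<psi>)"
  shows "concave_on {0..} \<psi>"
proof (rule concave_on_antimono_deriv_interior)
  show "continuous_on {0..} \<psi>"
    using K by (simp add: classK_def atLeast_def)
  show "(\<psi> has_real_derivative deriv \<psi> t) (at t)" if "t \<in> interior {0..}" for t
    using classK_deriv(1)[OF K, of t] that by simp
qed (use assms(2) in simp_all)

lemma classK_integral:
  assumes cont: "continuous_on {0<..} g" and pos: "\<And>t. 0 < t \<Longrightarrow> 0 < g t"
    and "0 < a" and near_0: "g integrable_on {0..a}"
  shows "classK \<infinity> (\<lambda>t. integral {0..t} g)"
    and "\<And>t. 0 < t \<Longrightarrow> ((\<lambda>t. integral {0..t} g) has_real_derivative g t) (at t)"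
proof -
  let ?G = "\<lambda>t. integral {0..t} g"
  have integrable: "g integrable_on {0..b}" for b
    using integrable_on_Icc_extend_right[OF near_0 \<open>0 < a\<close> cont] .
  show der: "(?G has_real_derivative g t) (at t)" if "0 < t" for t
    using has_real_derivative_integral_upper_limit[OF integrable[of "t + 1"]] cont that
    by (simp add: continuous_on_eq_continuous_at)
  then have deriv_eq: "deriv ?G t = g t" if "0 < t" for t
    using that DERIV_imp_deriv by blast
  have "continuous_on {0..} ?G"
    unfolding continuous_on_eq_continuous_within
  proof
    fix t :: real assume t: "t \<in> {0..}"
    then have "continuous (at t within {0..t + 1}) ?G"
      using indefinite_integral_continuous_1[OF integrable[of "t + 1"]]
      by (auto simp: continuous_on_eq_continuous_within)
    moreover have "at t within {0..t + 1} = at t within {0..}"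
      by (rule at_within_nhd[of _ "{..<t + 1}"]) (use t in auto)
    ultimately show "continuous (at t within {0..}) ?G" by simp
  qed
  moreover have "continuous_on {0<..} (deriv ?G)"
    using cont by (rule continuous_on_eq) (simp add: deriv_eq)
  ultimately show "classK \<infinity> ?G"
    unfolding classK_def using der deriv_eq pos
    by (auto simp: atLeast_def greaterThan_def real_differentiable_def)
qed

lemma concave_classK_dominating_running_inf:
  assumes K: "classK rb \<phi>" and a: "0 < a" "ereal a < rb"
  obtains \<psi> where "classK \<infinity> \<psi>" "concave_on {0..} \<psi>"
    "\<And>t. 0 < t \<Longrightarrow> running_inf (\<lambda>s. deriv \<phi> (min s a)) t \<le> deriv \<psi> t"
proof -
  define h where "h s = deriv \<phi> (min s a)" for s
  \<comment> \<open>the running infimum may vanish; the summand 1 keeps the derivative positive\<close>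
  define g where "g t = 1 + running_inf h t" for t
  define \<psi> where "\<psi> t = integral {0..t} g" for t
  have below: "ereal (min s a) < rb" for s
    by (rule ereal_le_less_trans[OF min.cobounded2 a(2)])
  have h_nonneg: "0 \<le> h s" if "0 < s" for s
    using classK_deriv(2)[OF K _ below, of s] that a by (simp add: h_def)
  then have bdd: "bdd_below (h ` {0<..})"
    by (intro bdd_belowI2[of _ 0]) simp
  have "continuous_on {0<..} h"
    unfolding h_def
    by (rule continuous_on_compose2[of "{t. 0 < t \<and> ereal t < rb}" "deriv \<phi>"])
      (use K a(1) below in \<open>auto simp: classK_def intro!: continuous_intros\<close>)
  then have cont: "continuous_on {0<..} g"
    unfolding g_def by (intro continuous_intros continuous_on_running_inf bdd)
  have pos: "0 < g t" if "0 < t" for t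
    using running_inf_greatest[OF that, of 0 h] h_nonneg by (force simp: g_def)
  have near_0: "g integrable_on {0..a}"
  proof (rule integrable_on_Icc_dominated)
    show "(\<lambda>s. 1 + deriv \<phi> s) integrable_on {0..a}"
      using classK_deriv_integrable_on[OF K] a by (intro integrable_add) auto
    show "norm (g s) \<le> 1 + deriv \<phi> s" if "0 < s" "s < a" for s
      using running_inf_le[OF bdd that(1), of s] pos[OF that(1)] that by (simp add: g_def h_def)
  qed (use cont in \<open>auto elim: continuous_on_subset\<close>)
  have \<psi>: "classK \<infinity> \<psi>" and deriv: "\<And>t. 0 < t \<Longrightarrow> (\<psi> has_real_derivative g t) (at t)"
    unfolding \<psi>_def using classK_integral[OF cont pos a(1) near_0] by auto
  have deriv_eq: "deriv \<psi> t = 1 + running_inf h t" if "0 < t" for t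
    using DERIV_imp_deriv[OF deriv[OF that]] by (simp add: g_def)
  have "antimono_on {0<..} (deriv \<psi>)"
    using antimono_on_running_inf[OF bdd] by (simp add: deriv_eq monotone_on_def)
  with \<psi> have "concave_on {0..} \<psi>"
    by (rule classK_concave_on)
  with \<psi> show ?thesis
    by (rule that) (simp add: deriv_eq flip: h_def)
qed

section \<open>Projection onto complete convex sets\<close>

lemma norm_diff_midpoint:
  fixes x a b :: "'a::real_inner"
  shows "4 * (norm (x - ((1/2) *\<^sub>R a + (1/2) *\<^sub>R b)))\<^sup>2 =
    2 * (norm (x - a))\<^sup>2 + 2 * (norm (x - b))\<^sup>2 - (norm (a - b))\<^sup>2"
  by (simp add: power2_norm_eq_inner inner_diff_left inner_diff_right inner_add_left
      inner_add_right inner_commute algebra_simps)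

lemma Cauchy_minimizing_sequence:
  fixes S :: "'a::real_inner set"
  assumes "convex S" and y: "\<And>n. y n \<in> S" and lim: "(\<lambda>n. dist x (y n)) \<longlonglongrightarrow> infdist x S"
  shows "Cauchy y"
proof (rule metric_CauchyI)
  fix e :: real assume "0 < e"
  let ?D = "(infdist x S)\<^sup>2"
  have dist_sq_le: "(dist a b)\<^sup>2 \<le> 2 * (dist x a)\<^sup>2 + 2 * (dist x b)\<^sup>2 - 4 * ?D"
    if "a \<in> S" "b \<in> S" for a b
  proof -
    have "(1/2) *\<^sub>R a + (1/2) *\<^sub>R b \<in> S"
      using \<open>convex S\<close> that by (simp add: convex_def)
    then have "?D \<le> (norm (x - ((1/2) *\<^sub>R a + (1/2) *\<^sub>R b)))\<^sup>2"
      using infdist_le infdist_nonneg by (metis dist_norm power_mono)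
    then show ?thesis
      using norm_diff_midpoint[of x a b] by (simp add: dist_norm)
  qed
  have "(\<lambda>n. (dist x (y n))\<^sup>2) \<longlonglongrightarrow> ?D"
    using lim by (rule tendsto_power)
  then have "\<forall>\<^sub>F n in sequentially. (dist x (y n))\<^sup>2 < ?D + e\<^sup>2 / 4"
    using \<open>0 < e\<close> by (intro order_tendstoD(2)) auto
  then obtain N where N: "(dist x (y n))\<^sup>2 < ?D + e\<^sup>2 / 4" if "N \<le> n" for n
    by (auto simp: eventually_sequentially)
  have "dist (y m) (y n) < e" if "N \<le> m" "N \<le> n" for m n
  proof (rule power2_less_imp_less)
    show "(dist (y m) (y n))\<^sup>2 < e\<^sup>2"
      using dist_sq_le[OF y y, of m n] N[OF that(1)] N[OF that(2)] by linarith
  qed (use \<open>0 < e\<close> in simp)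
  then show "\<exists>M. \<forall>m\<ge>M. \<forall>n\<ge>M. dist (y m) (y n) < e" by blast
qed

lemma closest_point_exists_complete:
  fixes S :: "'a::real_inner set"
  assumes "complete S" "convex S" "S \<noteq> {}"
  obtains y where "y \<in> S" "\<And>z. z \<in> S \<Longrightarrow> dist x y \<le> dist x z"
proof -
  have "\<exists>y\<in>S. dist x y < infdist x S + inverse (real (Suc n))" for n
    using \<open>S \<noteq> {}\<close> cINF_less_iff[of S "dist x" "infdist x S + inverse (real (Suc n))"]
    by (simp add: infdist_def)
  then obtain y where y: "\<And>n. y n \<in> S" "\<And>n. dist x (y n) < infdist x S + inverse (real (Suc n))"
    by metis
  have lim: "(\<lambda>n. dist x (y n)) \<longlonglongrightarrow> infdist x S"
  proof (rule tendsto_sandwich[where f = "\<lambda>_. infdist x S"])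
    show "(\<lambda>n. infdist x S + inverse (real (Suc n))) \<longlonglongrightarrow> infdist x S"
      using tendsto_add[OF tendsto_const LIMSEQ_inverse_real_of_nat] by simp
    show "\<forall>\<^sub>F n in sequentially. infdist x S \<le> dist x (y n)"
      using y(1) by (simp add: infdist_le)
    show "\<forall>\<^sub>F n in sequentially. dist x (y n) \<le> infdist x S + inverse (real (Suc n))"
      using y(2) by (simp add: less_imp_le)
  qed simp
  obtain l where l: "l \<in> S" "y \<longlonglongrightarrow> l"
    using completeE[OF \<open>complete S\<close> _ Cauchy_minimizing_sequence[OF \<open>convex S\<close> y(1) lim]] y(1) by blast
  then have "dist x l = infdist x S"
    using LIMSEQ_unique[OF tendsto_dist[OF tendsto_const] lim] by blast
  then show ?thesis
    using that l(1) by (simp add: infdist_le)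
qed

section \<open>Convex functions and their subgradients\<close>

definition subdifferential :: "('a::real_inner \<Rightarrow> ereal) \<Rightarrow> 'a \<Rightarrow> 'a set" where
  "subdifferential f x = {p. \<forall>z. f x + ereal (p \<bullet> (z - x)) \<le> f z}"

lemma subdifferential_monotone:
  assumes "p \<in> subdifferential f x" "q \<in> subdifferential f y" and "f x = ereal r" "f y = ereal s"
  shows "0 \<le> (p - q) \<bullet> (x - y)"
proof -
  have "r + p \<bullet> (y - x) \<le> s" "s + q \<bullet> (x - y) \<le> r"
    using assms by (auto simp: subdifferential_def dest: spec[of _ x] spec[of _ y])
  then show ?thesis by (simp add: inner_diff)
qed

lemma convex_ext_le:
  assumes "convex_ext f" and "f x \<le> ereal u" "f y \<le> ereal v" and t: "0 \<le> t" "t \<le> 1"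
  shows "f ((1 - t) *\<^sub>R x + t *\<^sub>R y) \<le> ereal ((1 - t) * u + t * v)"
proof (cases "t = 0 \<or> t = 1")
  case False
  then have t: "0 < t" "t < 1" using t by auto
  then have "f ((1 - t) *\<^sub>R x + t *\<^sub>R y) \<le> ereal (1 - t) * f x + ereal t * f y"
    using assms(1) by (simp add: convex_ext_def)
  also have "\<dots> \<le> ereal (1 - t) * ereal u + ereal t * ereal v"
    using t assms by (intro add_mono ereal_mult_left_mono) auto
  finally show ?thesis by simp
qed (use assms in auto)

lemma convex_sublevel_convex_ext:
  assumes "convex_ext f"
  shows "convex {x. f x \<le> ereal c}"
  unfolding convex_alt using convex_ext_le[OF assms] by (fastforce simp: algebra_simps)

lemma closed_sublevel_lsc_ext:
  fixes f :: "'a::topological_space \<Rightarrow> ereal"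
  assumes "lsc_ext f"
  shows "closed {x. f x \<le> c}"
  unfolding closed_limpt
proof (intro allI impI)
  fix x assume "x islimpt {x. f x \<le> c}"
  then have "\<exists>\<^sub>F y in at x. \<not> c < f y"
    by (simp add: islimpt_conv_frequently_at not_less)
  then have "\<not> c < Liminf (at x) f"
    using less_LiminfD[of c "at x" f] by (auto simp: frequently_def)
  then show "x \<in> {x. f x \<le> c}"
    using assms by (auto simp: lsc_ext_def not_less intro: order_trans)
qed

lemma strict_sublevel_in_open_halfspace:
  fixes f :: "'a::real_vector \<Rightarrow> ereal" and a :: "'a \<Rightarrow> real"
  assumes cvx: "convex_ext f" and "linear a" and sublevel: "\<And>z. f z \<le> ereal s \<Longrightarrow> a z \<le> c"
    and x: "f x < \<infinity>" "c < a x" and "f z < ereal s"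
  shows "a z < c"
proof -
  obtain u where u: "f z \<le> ereal u" "u < s"
    using \<open>f z < ereal s\<close> ereal_dense2[of "f z" "ereal s"] by (auto intro: less_imp_le)
  obtain r where r: "f x \<le> ereal r"
    using x(1) by (cases "f x") auto
  have "s < r"
  proof (rule ccontr)
    assume "\<not> s < r"
    then have "f x \<le> ereal s" using order_trans[OF r] by simp
    then show False using sublevel[of x] x(2) by simp
  qed
  define t where "t = (s - u) / (r - u)"
  have t: "0 < t" "t \<le> 1" using u \<open>s < r\<close> by (auto simp: t_def)
  have "t * (r - u) = s - u" using u \<open>s < r\<close> by (simp add: t_def)
  then have "(1 - t) * u + t * r = s" by (simp add: algebra_simps)
  then have "f ((1 - t) *\<^sub>R z + t *\<^sub>R x) \<le> ereal s"
    using convex_ext_le[OF cvx u(1) r, of t] t by simp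
  then have "a ((1 - t) *\<^sub>R z + t *\<^sub>R x) \<le> c" by (rule sublevel)
  then have "(1 - t) * a z + t * a x \<le> c"
    using \<open>linear a\<close> by (simp add: linear_add linear_scale)
  moreover have "t * c < t * a x" using t x(2) by simp
  ultimately have "(1 - t) * a z < (1 - t) * c"
    by (simp add: algebra_simps)
  then show ?thesis using t by (auto simp: mult_less_cancel_left)
qed

lemma secant_slopes_across_hyperplane:
  fixes f :: "'a::real_vector \<Rightarrow> ereal" and a :: "'a \<Rightarrow> real"
  assumes cvx: "convex_ext f" and "linear a" and hyperplane_ge: "\<And>z. a z = c \<Longrightarrow> ereal s \<le> f z"
    and w: "f w \<le> ereal u" "a w < c" and z: "f z \<le> ereal v" "c < a z"
  shows "(s - u) / (c - a w) \<le> (v - s) / (a z - c)"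
proof -
  define t where "t = (c - a w) / (a z - a w)"
  have t: "0 \<le> t" "t \<le> 1" using w z by (auto simp: t_def)
  have t_mult: "t * (a z - a w) = c - a w" using w z by (simp add: t_def)
  then have "(1 - t) * a w + t * a z = c" by (simp add: algebra_simps)
  then have "a ((1 - t) *\<^sub>R w + t *\<^sub>R z) = c"
    using \<open>linear a\<close> by (simp add: linear_add linear_scale)
  then have "s \<le> (1 - t) * u + t * v"
    using order_trans[OF hyperplane_ge convex_ext_le[OF cvx w(1) z(1) t]] by simp
  then have "(a z - a w) * s \<le> (a z - a w) * ((1 - t) * u + t * v)"
    using w z by (intro mult_left_mono) auto
  also have "\<dots> = (a z - a w) * u + t * (a z - a w) * (v - u)" by (simp add: algebra_simps)
  also have "\<dots> = (a z - a w) * u + (c - a w) * (v - u)" unfolding t_mult ..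
  finally have "(a z - c) * (s - u) \<le> (c - a w) * (v - s)" by (simp add: algebra_simps)
  then show ?thesis using w z by (simp add: frac_le_eq divide_simps mult.commute)
qed

lemma lagrange_multiplier_hyperplane:
  fixes f :: "'a::real_vector \<Rightarrow> ereal" and a :: "'a \<Rightarrow> real"
  assumes cvx: "convex_ext f" and "linear a" and hyperplane_ge: "\<And>z. a z = c \<Longrightarrow> ereal s \<le> f z"
    and x: "f x < \<infinity>" "c < a x" and w: "f w < \<infinity>" "a w < c"
  obtains l where "\<And>z. ereal (s + l * (a z - c)) \<le> f z"
proof -
  define slopes where "slopes = {(s - u) / (c - a w) | w u. f w \<le> ereal u \<and> a w < c}"
  note slope_le = secant_slopes_across_hyperplane[OF cvx \<open>linear a\<close> hyperplane_ge]
  obtain u v where uv: "f w \<le> ereal u" "f x \<le> ereal v"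
    using w(1) x(1) by (cases "f w"; cases "f x") auto
  have slopes_ne: "slopes \<noteq> {}" using uv(1) w(2) by (auto simp: slopes_def)
  have slopes_bdd: "bdd_above slopes"
    by (rule bdd_aboveI[of _ "(v - s) / (a x - c)"])
      (use slope_le uv(2) x(2) in \<open>auto simp: slopes_def\<close>)
  have Sup_le: "s + Sup slopes * (a z - c) \<le> v" if v: "f z \<le> ereal v" for z v
  proof (cases "a z" c rule: linorder_cases)
    case less
    then have "(s - v) / (c - a z) \<le> Sup slopes"
      using v by (intro cSup_upper[OF _ slopes_bdd]) (auto simp: slopes_def)
    then show ?thesis using less by (simp add: field_simps)
  next
    case equal
    then show ?thesis using hyperplane_ge[of z] v by (auto dest: order_trans)
  next
    case greater
    then have "Sup slopes \<le> (v - s) / (a z - c)"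
      using slope_le v by (intro cSup_least[OF slopes_ne]) (auto simp: slopes_def)
    then show ?thesis using greater by (simp add: field_simps)
  qed
  have "ereal (s + Sup slopes * (a z - c)) \<le> f z" for z
    by (rule ereal_le_real) (simp add: Sup_le)
  then show ?thesis using that by blast
qed

lemma subgradient_along_sublevel_normal:
  fixes f :: "'a::real_inner \<Rightarrow> ereal"
  assumes cvx: "convex_ext f" and sublevel: "\<And>z. f z \<le> ereal s \<Longrightarrow> n \<bullet> z \<le> n \<bullet> y"
    and y: "f y \<le> ereal s" and w: "f w < ereal s" and x: "f x < \<infinity>" "n \<bullet> y < n \<bullet> x"
  obtains l where "f y = ereal s" "0 < l" "l *\<^sub>R n \<in> subdifferential f y"
proof -
  have lin: "linear ((\<bullet>) n)"
    by (rule bounded_linear.linear[OF bounded_linear_inner_right])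
  have strict_sublevel: "n \<bullet> z < n \<bullet> y" if "f z < ereal s" for z
    using strict_sublevel_in_open_halfspace[OF cvx lin sublevel x that] .
  then have hyperplane_ge: "ereal s \<le> f z" if "n \<bullet> z = n \<bullet> y" for z
    using that by (force simp: not_less[symmetric])
  then have fy: "f y = ereal s" using y by (simp add: antisym)
  have "f w < \<infinity>" using w by auto
  then obtain l where l: "\<And>z. ereal (s + l * (n \<bullet> z - n \<bullet> y)) \<le> f z"
    using lagrange_multiplier_hyperplane[OF cvx lin hyperplane_ge x _ strict_sublevel[OF w]] by blast
  have "l * (n \<bullet> w - n \<bullet> y) < 0"
    using le_less_trans[OF l w] by simp
  then have "0 < l" using strict_sublevel[OF w] by (simp add: mult_less_0_iff)
  moreover have "l *\<^sub>R n \<in> subdifferential f y"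
    using l by (simp add: subdifferential_def fy inner_diff_right right_diff_distrib)
  ultimately show ?thesis using that fy by blast
qed

lemma norm_subgradient_le_if_collinear:
  assumes p: "p \<in> subdifferential f x" and q: "l *\<^sub>R (x - y) \<in> subdifferential f y"
    and "f x = ereal r" "f y = ereal s" "0 \<le> l"
  shows "norm (l *\<^sub>R (x - y)) \<le> norm p"
proof (cases "x = y")
  case False
  have "l * (norm (x - y))\<^sup>2 \<le> p \<bullet> (x - y)"
    using subdifferential_monotone[OF p q assms(3,4)]
    by (simp add: inner_diff_left[of p] power2_norm_eq_inner)
  also have "\<dots> \<le> norm p * norm (x - y)" by (rule norm_cauchy_schwarz)
  finally show ?thesis
    using False \<open>0 \<le> l\<close> by (simp add: power2_eq_square)
qed simp

lemma subgradient_at_lower_level: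
  fixes f :: "'a::{real_inner, complete_space} \<Rightarrow> ereal"
  assumes lsc: "lsc_ext f" and cvx: "convex_ext f"
    and w: "f w < ereal s" and x: "f x = ereal r" "s < r" and p: "p \<in> subdifferential f x"
  obtains y q where "f y = ereal s" "q \<in> subdifferential f y" "norm q \<le> norm p"
proof -
  let ?S = "{z. f z \<le> ereal s}"
  have S: "closed ?S" "convex ?S" "?S \<noteq> {}"
    using closed_sublevel_lsc_ext[OF lsc] convex_sublevel_convex_ext[OF cvx] w
    by (auto intro: less_imp_le)
  obtain y where y: "y \<in> ?S" "\<And>z. z \<in> ?S \<Longrightarrow> dist x y \<le> dist x z"
    using closest_point_exists_complete[of ?S] S complete_eq_closed by blast
  have "(x - y) \<bullet> z \<le> (x - y) \<bullet> y" if "f z \<le> ereal s" for z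
    using any_closest_point_dot[OF S(2,1) y(1), of z x] y(2) that by (simp add: inner_diff_right)
  moreover have "(x - y) \<bullet> y < (x - y) \<bullet> x"
  proof -
    have "x \<noteq> y" using y(1) x by auto
    then have "0 < (x - y) \<bullet> (x - y)" by simp
    then show ?thesis unfolding inner_diff_right[of "x - y"] by simp
  qed
  ultimately obtain l where "f y = ereal s" "0 < l" "l *\<^sub>R (x - y) \<in> subdifferential f y"
    using subgradient_along_sublevel_normal[OF cvx _ _ w, of "x - y" y x] y(1) x(1) by auto
  then show ?thesis
    using that norm_subgradient_le_if_collinear[OF p _ x(1)] by (metis less_imp_le)
qed

section \<open>Chain rule for the Frechet subdifferential\<close>

lemma frechet_subdiff_if_minorant:
  fixes g :: "'a::real_inner \<Rightarrow> ereal"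
  assumes der: "(\<theta> has_derivative (\<lambda>h. q \<bullet> h)) (at x)" and gx: "g x = ereal (\<theta> x)"
    and minorant: "\<forall>\<^sub>F y in at x. ereal (\<theta> y) \<le> g y"
  shows "q \<in> frechet_subdiff g x"
proof -
  let ?Q = "\<lambda>y. (g y - g x - ereal (q \<bullet> (y - x))) / ereal (norm (y - x))"
  let ?R = "\<lambda>y. ereal ((\<theta> y - \<theta> x - q \<bullet> (y - x)) / norm (y - x))"
  have lim: "(?R \<longlongrightarrow> ereal 0) (at x)"
    using der by (intro tendsto_ereal) (simp add: has_derivative_at_within divide_inverse_commute)
  have quot_ge: "\<forall>\<^sub>F y in at x. ?R y \<le> ?Q y"
    using minorant eventually_neq_at_within[of x]
  proof eventually_elim
    case (elim y)
    then have "ereal (\<theta> y) - ereal (\<theta> x) - ereal (q \<bullet> (y - x)) \<le> g y - g x - ereal (q \<bullet> (y - x))"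
      by (intro ereal_minus_mono) (auto simp: gx)
    then show ?case
      using elim(2) ereal_divide_right_mono[of _ _ "ereal (norm (y - x))"] by fastforce
  qed
  have "0 \<le> Liminf (at x) ?Q"
    unfolding le_Liminf_iff
  proof (intro allI impI)
    fix c :: ereal assume "c < 0"
    then have "\<forall>\<^sub>F y in at x. c < ?R y"
      by (intro order_tendstoD(1)[OF lim]) (simp add: zero_ereal_def)
    with quot_ge show "\<forall>\<^sub>F y in at x. c < ?Q y"
      by eventually_elim (rule less_le_trans)
  qed
  then show ?thesis
    by (simp add: frechet_subdiff_def edom_def gx)
qed

lemma filterlim_at_ray:
  fixes x u :: "'a::real_normed_vector"
  assumes "u \<noteq> 0"
  shows "filterlim (\<lambda>t. x + t *\<^sub>R u) (at x) (at_right 0)"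
proof (rule filterlim_atI)
  show "((\<lambda>t. x + t *\<^sub>R u) \<longlongrightarrow> x) (at_right 0)"
    by (rule tendsto_eq_intros refl | simp)+
  show "\<forall>\<^sub>F t in at_right 0. x + t *\<^sub>R u \<noteq> x"
    using eventually_at_right_less[of "0::real"] by eventually_elim (use assms in simp)
qed

lemma frechet_subdiff_inner_le_if_ray_majorant:
  fixes g :: "'a::real_inner \<Rightarrow> ereal"
  assumes q: "q \<in> frechet_subdiff g x" and gx: "g x = ereal (\<gamma> 0)" and "u \<noteq> 0"
    and der: "(\<gamma> has_real_derivative D) (at_right 0)"
    and majorant: "\<forall>\<^sub>F t in at_right 0. g (x + t *\<^sub>R u) \<le> ereal (\<gamma> t)"
  shows "q \<bullet> u \<le> D"
proof -
  let ?Q = "\<lambda>y. (g y - g x - ereal (q \<bullet> (y - x))) / ereal (norm (y - x))"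
  have quot_le: "\<forall>\<^sub>F t in at_right 0. ?Q (x + t *\<^sub>R u) \<le> ereal (((\<gamma> t - \<gamma> 0) / t - q \<bullet> u) / norm u)"
    using majorant eventually_at_right_less[of "0::real"]
  proof eventually_elim
    case (elim t)
    then have "g (x + t *\<^sub>R u) - g x - ereal (q \<bullet> (t *\<^sub>R u))
        \<le> ereal (\<gamma> t) - ereal (\<gamma> 0) - ereal (q \<bullet> (t *\<^sub>R u))"
      by (intro ereal_minus_mono) (auto simp: gx)
    then have "(g (x + t *\<^sub>R u) - g x - ereal (q \<bullet> (t *\<^sub>R u))) / ereal (norm (t *\<^sub>R u))
        \<le> (ereal (\<gamma> t) - ereal (\<gamma> 0) - ereal (q \<bullet> (t *\<^sub>R u))) / ereal (norm (t *\<^sub>R u))"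
      by (rule ereal_divide_right_mono) (use elim(2) \<open>u \<noteq> 0\<close> in simp)
    also have "\<dots> = ereal (((\<gamma> t - \<gamma> 0) / t - q \<bullet> u) / norm u)"
      using elim(2) \<open>u \<noteq> 0\<close> by (simp add: field_simps)
    finally show ?case by simp
  qed
  have "0 \<le> (D - q \<bullet> u) / norm u"
  proof (rule ccontr)
    assume "\<not> 0 \<le> (D - q \<bullet> u) / norm u"
    then obtain c where c: "(D - q \<bullet> u) / norm u < c" "c < 0"
      using dense not_le by blast
    have "((\<lambda>t. ((\<gamma> t - \<gamma> 0) / t - q \<bullet> u) / norm u) \<longlongrightarrow> (D - q \<bullet> u) / norm u) (at_right 0)"
      using der \<open>u \<noteq> 0\<close> by (intro tendsto_intros) (auto simp: has_field_derivative_iff)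
    then have "\<forall>\<^sub>F t in at_right 0. ((\<gamma> t - \<gamma> 0) / t - q \<bullet> u) / norm u < c"
      using c(1) by (rule order_tendstoD(2))
    moreover have "\<forall>\<^sub>F y in at x. ereal c < ?Q y"
      using q c(2) by (auto simp: frechet_subdiff_def le_Liminf_iff split: if_splits)
    then have "\<forall>\<^sub>F t in at_right 0. ereal c < ?Q (x + t *\<^sub>R u)"
      using filterlim_at_ray[OF \<open>u \<noteq> 0\<close>] by (rule eventually_compose_filterlim)
    ultimately have "\<forall>\<^sub>F t in at_right (0::real). False"
      using quot_le by eventually_elim (auto dest: less_le_trans)
    then show False by simp
  qed
  then show ?thesis using \<open>u \<noteq> 0\<close> by (simp add: zero_le_divide_iff)
qed

lemma frechet_subdiff_compK_empty:
  assumes "\<not> f x < rb"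
  shows "frechet_subdiff (compK \<phi> rb f) x = {}"
  using assms by (simp add: frechet_subdiff_def edom_def compK_def)

lemma le_compK:
  assumes "mono_on {t. 0 \<le> t \<and> ereal t < rb} \<phi>" and "0 \<le> t" "ereal t \<le> f y"
  shows "ereal (\<phi> t) \<le> compK \<phi> rb f y"
proof (cases "f y < rb \<and> f y \<noteq> \<infinity>")
  case True
  then obtain u where u: "f y = ereal u" "t \<le> u"
    using assms(3) by (cases "f y") auto
  then have "\<phi> t \<le> \<phi> u"
    using True assms(2) by (intro mono_onD[OF assms(1)]) (auto intro: ereal_le_less_trans)
  then show ?thesis using u True assms(2) by (simp add: compK_def)
qed (auto simp: compK_def)

lemma compK_le:
  assumes "mono_on {t. 0 \<le> t \<and> ereal t < rb} \<phi>" and "0 \<le> f y" "f y \<le> ereal t" "ereal t < rb"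
  shows "compK \<phi> rb f y \<le> ereal (\<phi> t)"
proof -
  obtain u where u: "f y = ereal u" "0 \<le> u" "u \<le> t"
    using assms(2,3) by (cases "f y") auto
  then have "ereal u < rb" using assms(4) by (blast intro: ereal_le_less_trans)
  then show ?thesis
    using u assms(4) by (auto simp: compK_def intro!: mono_onD[OF assms(1)])
qed

lemma scaleR_subgradient_in_frechet_subdiff_compK:
  fixes f :: "'a::real_inner \<Rightarrow> ereal"
  assumes fx: "f x = ereal r" "0 < r" "ereal r < rb"
    and mono: "mono_on {t. 0 \<le> t \<and> ereal t < rb} \<phi>"
    and der: "(\<phi> has_real_derivative d) (at r)" and p: "p \<in> subdifferential f x"
  shows "d *\<^sub>R p \<in> frechet_subdiff (compK \<phi> rb f) x"
proof (rule frechet_subdiff_if_minorant)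
  let ?m = "\<lambda>y. r + p \<bullet> (y - x)"
  show "((\<lambda>y. \<phi> (?m y)) has_derivative (\<lambda>h. d *\<^sub>R p \<bullet> h)) (at x)"
  proof -
    have "(\<phi> has_derivative (*) d) (at (?m x))"
      using der by (simp add: has_field_derivative_def)
    moreover have "(?m has_derivative (\<lambda>h. p \<bullet> h)) (at x)"
      by (auto intro!: derivative_eq_intros)
    ultimately show ?thesis
      using has_derivative_compose[of ?m "\<lambda>h. p \<bullet> h" x UNIV \<phi> "(*) d"] by simp
  qed
  have "(?m \<longlongrightarrow> r) (at x)"
    by (rule tendsto_eq_intros refl | simp)+
  then have "\<forall>\<^sub>F y in at x. 0 < ?m y"
    using fx(2) by (rule order_tendstoD(1))
  then show "\<forall>\<^sub>F y in at x. ereal (\<phi> (?m y)) \<le> compK \<phi> rb f y"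
    by eventually_elim (use p fx(1) in \<open>auto simp: subdifferential_def intro!: le_compK[OF mono]\<close>)
qed (use fx in \<open>simp add: compK_def\<close>)

lemma subgradient_of_frechet_subdiff_compK:
  fixes f :: "'a::real_inner \<Rightarrow> ereal"
  assumes cvx: "convex_ext f" and nonneg: "\<And>z. 0 \<le> f z"
    and fx: "f x = ereal r" "0 < r" "ereal r < rb"
    and mono: "mono_on {t. 0 \<le> t \<and> ereal t < rb} \<phi>"
    and der: "(\<phi> has_real_derivative d) (at r)" and "0 < d"
    and q: "q \<in> frechet_subdiff (compK \<phi> rb f) x"
  shows "q /\<^sub>R d \<in> subdifferential f x"
proof -
  have "ereal (r + (q /\<^sub>R d) \<bullet> (z - x)) \<le> ereal v" if v: "f z \<le> ereal v" for z v
  proof (cases "z = x")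
    case False
    let ?m = "\<lambda>t. r + t * (v - r)"
    have "q \<bullet> (z - x) \<le> d * (v - r)"
    proof (rule frechet_subdiff_inner_le_if_ray_majorant[OF q])
      have "((\<lambda>t. \<phi> (?m t)) has_real_derivative d * (v - r)) (at 0)"
        by (rule DERIV_chain2[where f = \<phi> and g = ?m])
          (use der in \<open>auto intro!: derivative_eq_intros\<close>)
      then show "((\<lambda>t. \<phi> (?m t)) has_real_derivative d * (v - r)) (at_right 0)"
        by (rule has_field_derivative_at_within)
      have "((\<lambda>t. ereal (?m t)) \<longlongrightarrow> ereal r) (at_right 0)"
        by (intro tendsto_ereal) (rule tendsto_eq_intros refl | simp)+
      then have "\<forall>\<^sub>F t in at_right 0. ereal (?m t) < rb"
        using fx(3) by (rule order_tendstoD(2))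
      then show "\<forall>\<^sub>F t in at_right 0. compK \<phi> rb f (x + t *\<^sub>R (z - x)) \<le> ereal (\<phi> (?m t))"
        using eventually_at_right_real[of 0 "1::real", simplified]
      proof eventually_elim
        case (elim t)
        have "x + t *\<^sub>R (z - x) = (1 - t) *\<^sub>R x + t *\<^sub>R z" by (simp add: algebra_simps)
        then have "f (x + t *\<^sub>R (z - x)) \<le> ereal (?m t)"
          using convex_ext_le[OF cvx _ v, of x r t] fx(1) elim(2) by (simp add: algebra_simps)
        then show ?case
          using elim(1) by (rule compK_le[where f = f, OF mono nonneg])
      qed
    qed (use fx False in \<open>simp_all add: compK_def\<close>)
    then show ?thesis using \<open>0 < d\<close> by (simp add: field_simps)
  qed (use v fx(1) in simp)
  then show ?thesis
    by (auto simp: subdifferential_def fx(1) intro: ereal_le_real)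
qed

lemma frechet_subdiff_compK_eq:
  fixes f :: "'a::real_inner \<Rightarrow> ereal"
  assumes "convex_ext f" "\<And>z. 0 \<le> f z" and K: "classK rb \<phi>"
    and fx: "f x = ereal r" "0 < r" "ereal r < rb"
  shows "frechet_subdiff (compK \<phi> rb f) x = (*\<^sub>R) (deriv \<phi> r) ` subdifferential f x"
proof (rule set_eqI)
  fix q
  note deriv = classK_deriv[OF K fx(2,3)]
  have "q \<in> (*\<^sub>R) (deriv \<phi> r) ` subdifferential f x"
    if "q \<in> frechet_subdiff (compK \<phi> rb f) x"
    using subgradient_of_frechet_subdiff_compK[OF assms(1,2) fx classK_mono_on[OF K] deriv that]
      deriv(2) by (intro image_eqI[of _ _ "q /\<^sub>R deriv \<phi> r"]) auto
  then show "q \<in> frechet_subdiff (compK \<phi> rb f) x \<longleftrightarrow>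
      q \<in> (*\<^sub>R) (deriv \<phi> r) ` subdifferential f x"
    using scaleR_subgradient_in_frechet_subdiff_compK[where f = f and x = x,
        OF fx classK_mono_on[OF K] deriv(1)] by blast
qed

section \<open>Desingularization\<close>

definition desingularizing_slope :: "('a::real_inner \<Rightarrow> ereal) \<Rightarrow> ereal \<Rightarrow> (real \<Rightarrow> real) \<Rightarrow> bool" where
  "desingularizing_slope f rb h \<longleftrightarrow>
    (\<forall>x r p. f x = ereal r \<and> 0 < r \<and> ereal r < rb \<and> p \<in> subdifferential f x \<longrightarrow> 1 \<le> h r * norm p)"

lemma desingularizing_slope_mono:
  assumes "desingularizing_slope f rb h" and "rb' \<le> rb"
    and "\<And>r. 0 < r \<Longrightarrow> ereal r < rb' \<Longrightarrow> h r \<le> k r"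
  shows "desingularizing_slope f rb' k"
  unfolding desingularizing_slope_def
proof (intro allI impI, elim conjE)
  fix x r p
  assume x: "f x = ereal r" "0 < r" "ereal r < rb'" "p \<in> subdifferential f x"
  then have "1 \<le> h r * norm p"
    using assms(1,2) by (auto simp: desingularizing_slope_def dest: less_le_trans)
  also have "\<dots> \<le> k r * norm p"
    using assms(3) x by (simp add: mult_right_mono)
  finally show "1 \<le> k r * norm p" .
qed

lemma desingularizing_slope_deriv_iff:
  fixes f :: "'a::real_inner \<Rightarrow> ereal"
  assumes f: "convex_ext f" "\<And>z. 0 \<le> f z" and K: "classK rb \<phi>" and "rb \<le> c"
  shows "desingularizing_slope f rb (deriv \<phi>) \<longleftrightarrow>
    (\<forall>x. 0 < f x \<and> f x \<le> c \<longrightarrow> 1 \<le> lower_norm (frechet_subdiff (compK \<phi> rb f) x))"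
proof -
  have below_radius: "1 \<le> lower_norm (frechet_subdiff (compK \<phi> rb f) x) \<longleftrightarrow>
      (\<forall>p\<in>subdifferential f x. 1 \<le> deriv \<phi> r * norm p)"
    if x: "f x = ereal r" "0 < r" "ereal r < rb" for x r
    using classK_deriv(2)[OF K x(2,3)]
    by (simp add: frechet_subdiff_compK_eq[OF f K x] lower_norm_def le_INF_iff)
  have beyond_radius: "1 \<le> lower_norm (frechet_subdiff (compK \<phi> rb f) x)" if "\<not> f x < rb" for x
    using that by (simp add: frechet_subdiff_compK_empty lower_norm_def)
  show ?thesis
    unfolding desingularizing_slope_def
  proof (intro iffI allI impI; elim conjE)
    fix x
    assume slope: "\<forall>x r p. f x = ereal r \<and> 0 < r \<and> ereal r < rb \<and> p \<in> subdifferential f x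
        \<longrightarrow> 1 \<le> deriv \<phi> r * norm p" and "0 < f x"
    show "1 \<le> lower_norm (frechet_subdiff (compK \<phi> rb f) x)"
    proof (cases "f x < rb")
      case True
      then obtain r where "f x = ereal r" "0 < r" using \<open>0 < f x\<close> by (cases "f x") auto
      then show ?thesis using slope below_radius True by simp
    qed (rule beyond_radius)
  next
    fix x r p
    assume "\<forall>x. 0 < f x \<and> f x \<le> c \<longrightarrow> 1 \<le> lower_norm (frechet_subdiff (compK \<phi> rb f) x)"
      and x: "f x = ereal r" "0 < r" "ereal r < rb" "p \<in> subdifferential f x"
    then show "1 \<le> deriv \<phi> r * norm p"
      using below_radius[OF x(1-3)] \<open>rb \<le> c\<close> by (auto intro: less_imp_le order_trans)
  qed
qed

lemma desingularizing_slope_running_inf: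
  fixes f :: "'a::{real_inner, complete_space} \<Rightarrow> ereal"
  assumes f: "lsc_ext f" "convex_ext f" "(INF x. f x) \<le> 0"
    and slope: "desingularizing_slope f rb h" and a: "0 < a" "ereal a < rb"
  shows "desingularizing_slope f \<infinity> (running_inf (\<lambda>s. h (min s a)))"
  unfolding desingularizing_slope_def
proof (intro allI impI, elim conjE)
  fix x r p
  assume x: "f x = ereal r" "0 < r" and p: "p \<in> subdifferential f x"
  have bound: "1 \<le> h s * norm p" if s: "0 < s" "s \<le> r" "s \<le> a" for s
  proof -
    have "ereal s < rb"
      using s(3) a(2) by (rule ereal_le_less_trans)
    obtain y q where y: "f y = ereal s" "q \<in> subdifferential f y" "norm q \<le> norm p"
    proof (cases "s = r")
      case True
      then show ?thesis using that x(1) p by blast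
    next
      case False
      have "(INF x. f x) < ereal s" using f(3) s(1) by (simp add: le_less_trans)
      then obtain w where "f w < ereal s" by (auto simp: INF_less_iff)
      then show ?thesis
        using subgradient_at_lower_level[OF f(1,2) _ x(1) _ p] False s(2) that by force
    qed
    have "1 \<le> h s * norm q"
      using slope y(1,2) s(1) \<open>ereal s < rb\<close> by (auto simp: desingularizing_slope_def)
    moreover from this have "0 < h s * norm q" by simp
    then have "0 < h s" by (simp add: zero_less_mult_iff)
    ultimately show ?thesis
      using mult_left_mono[OF y(3), of "h s"] by linarith
  qed
  have "p \<noteq> 0" using bound[of "min r a"] x(2) a(1) by auto
  then have "1 / norm p \<le> running_inf (\<lambda>s. h (min s a)) r"
    using bound a(1) by (intro running_inf_greatest[OF x(2)]) (simp add: divide_le_eq)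
  then show "1 \<le> running_inf (\<lambda>s. h (min s a)) r * norm p"
    using \<open>p \<noteq> 0\<close> by (simp add: divide_le_eq)
qed

lemma concave_desingularization:
  fixes f :: "'a::{real_inner, complete_space} \<Rightarrow> ereal"
  assumes f: "lsc_ext f" "convex_ext f" "(INF x. f x) \<le> 0"
    and K: "classK rb \<phi>" and "0 < rb" and slope: "desingularizing_slope f rb (deriv \<phi>)"
  obtains \<psi> where "classK \<infinity> \<psi>" "concave_on {0..} \<psi>" "desingularizing_slope f \<infinity> (deriv \<psi>)"
proof -
  obtain a where a: "0 < a" "ereal a < rb"
    using ereal_dense2[OF \<open>0 < rb\<close>] by auto
  obtain \<psi> where \<psi>: "classK \<infinity> \<psi>" "concave_on {0..} \<psi>"
    "\<And>t. 0 < t \<Longrightarrow> running_inf (\<lambda>s. deriv \<phi> (min s a)) t \<le> deriv \<psi> t"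
    using concave_classK_dominating_running_inf[OF K a] by blast
  have "desingularizing_slope f \<infinity> (deriv \<psi>)"
    using desingularizing_slope_running_inf[OF f slope a] order_refl \<psi>(3)
    by (rule desingularizing_slope_mono)
  then show ?thesis using that \<psi>(1,2) by blast
qed

theorem theorem4p4:
  fixes f :: "'a::{real_inner, complete_space} \<Rightarrow> ereal"
  assumes "lsc_ext f" and "proper_ext f" and "convex_ext f"
    and "(INF x. f x) = 0"
  shows "(\<exists>r0::real. r0 > 0 \<and> (\<exists>\<phi>. classK (ereal r0) \<phi> \<and>
            (\<forall>x. 0 < f x \<and> f x \<le> ereal r0 \<longrightarrow>
                 lower_norm (frechet_subdiff (compK \<phi> (ereal r0) f) x) \<ge> 1)))
     \<longleftrightarrow>
         (\<exists>\<psi>. classK \<infinity> \<psi> \<and> concave_on {0..} \<psi> \<and>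
            (\<forall>x. f x \<noteq> 0 \<longrightarrow> lower_norm (frechet_subdiff (compK \<psi> \<infinity> f) x) \<ge> 1))"
    (is "(\<exists>r0. 0 < r0 \<and> (\<exists>\<phi>. classK _ \<phi> \<and> ?local r0 \<phi>)) \<longleftrightarrow>
         (\<exists>\<psi>. classK \<infinity> \<psi> \<and> ?concave \<psi> \<and> ?global \<psi>)")
proof -
  have nonneg: "0 \<le> f z" for z
    using INF_lower[of z UNIV f] assms(4) by simp
  note slope_iff = desingularizing_slope_deriv_iff[OF assms(3) nonneg _ order_refl]
  have local_iff: "?local r0 \<phi> \<longleftrightarrow> desingularizing_slope f (ereal r0) (deriv \<phi>)"
    if "classK (ereal r0) \<phi>" for r0 \<phi>
    using slope_iff[OF that] by simp
  have global_iff: "?global \<psi> \<longleftrightarrow> desingularizing_slope f \<infinity> (deriv \<psi>)" if "classK \<infinity> \<psi>" for \<psi>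
    using slope_iff[OF that] by (simp add: less_le nonneg neq_commute[of 0])
  show ?thesis
  proof safe
    fix r0 \<phi> assume "0 < r0" "classK (ereal r0) \<phi>" "?local r0 \<phi>"
    then obtain \<psi> where "classK \<infinity> \<psi>" "?concave \<psi>" "desingularizing_slope f \<infinity> (deriv \<psi>)"
      using concave_desingularization[OF assms(1,3), of "ereal r0" \<phi>] assms(4) local_iff by auto
    then show "\<exists>\<psi>. classK \<infinity> \<psi> \<and> ?concave \<psi> \<and> ?global \<psi>" using global_iff by blast
  next
    fix \<psi> assume "classK \<infinity> \<psi>" "?global \<psi>"
    then have "classK (ereal 1) \<psi>" "desingularizing_slope f (ereal 1) (deriv \<psi>)"
      using global_iff by (auto intro: classK_antimono_radius elim: desingularizing_slope_mono)
    then show "\<exists>r0>0. \<exists>\<phi>. classK (ereal r0) \<phi> \<and> ?local r0 \<phi>"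
      using local_iff zero_less_one by blast
  qed
qed

end
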